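(* Let $\varpi:\mathcal{E}\to\mathbb{R}_+$ be measurable and $r\in[1,2]$. Then for any $(\mathcal{A},\mathrm{Bor}(\bar J))$-measurable $f,g:\mathcal{E}\to\bar J$ such that all terms below are finite, $$\left\|(f-g)\,\varpi\right\|_{L^r(g\in J)}^2\le\left(\int_0^1(1-\tau)\left\|\frac{\varpi^2}{\Phi''((1-\tau)g+\tau f)}\right\|_{L^{\frac r{2-r}}(g\in J)}^{-1}d\tau\right)^{-1}\mathcal{H}_\Phi[f|g].$$
   Context: $(\mathcal{E},\mathcal{A},\mu)$ is a measured space, $J\subset\mathbb{R}$ an open interval with closure $\bar J$, and $\Phi\in\mathcal{C}^2(J)\cap\mathcal{C}^0(\bar J)$ satisfies $\Phi''>0$ on $J$. For $(\mathcal{A},\mathrm{Bor}(\bar J))$-measurable $f,g:\mathcal{E}\to\bar J$, $$\mathcal{H}_\Phi[f|g]:=\int_0^1(1-\tau)\left(\int_{\{g\in J\}}(f-g)^2\,\Phi''((1-\tau)g+\tau f)\,d\mu(\zeta)\right)d\tau\in[0,+\infty]$$ (if $g(\zeta)\in J$ then $(1-\tau)g(\zeta)+\tau f(\zeta)\in J$ for all $\tau\in(0,1)$). $L^q(g\in J)$ denotes the $L^q$ space on the set $\{\zeta\in\mathcal{E}:g(\zeta)\in J\}$ with the measure $\mu$; when $r=2$, $L^{\frac r{2-r}}$ is understood as $L^\infty$. *)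

theory Defs
  imports "HOL-Analysis.Analysis" "HOL-Probability.Essential_Supremum"
begin

text \<open>
  The library's \<open>deriv\<close> is two-sided, so the following is meant for open sets \<open>J\<close>.
\<close>

definition C2_on :: "real set \<Rightarrow> (real \<Rightarrow> real) \<Rightarrow> bool" where
  "C2_on J \<Phi> \<longleftrightarrow>
     (\<forall>x\<in>J. \<Phi> field_differentiable at x) \<and>
     (\<forall>x\<in>J. deriv \<Phi> field_differentiable at x) \<and>
     continuous_on J (deriv (deriv \<Phi>))"

text \<open>
  Norms are extended nonnegative reals, so they are defined, possibly as \<open>\<infinity>\<close>, for every
  measurable function. The else-branch is \<open>I powr (1 / q)\<close> for \<open>I\<close> in \<open>[0, \<infinity>]\<close>; the
  library has no \<open>powr\<close> on \<open>ennreal\<close>. The exponent is meant to lie in \<open>[1, \<infinity>]\<close>.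
\<close>

definition Lnorm :: "ennreal \<Rightarrow> 'a measure \<Rightarrow> ('a \<Rightarrow> real) \<Rightarrow> ennreal" where
  "Lnorm q M h =
     (if q = \<infinity> then esssup M (\<lambda>x. ennreal \<bar>h x\<bar>)
      else let I = (\<integral>\<^sup>+x. ennreal (\<bar>h x\<bar> powr enn2real q) \<partial>M)
           in if I = \<infinity> then \<infinity> else ennreal (enn2real I powr (1 / enn2real q)))"

definition measure_in :: "'a measure \<Rightarrow> ('a \<Rightarrow> real) \<Rightarrow> real set \<Rightarrow> 'a measure" where
  "measure_in M g J = restrict_space M {\<zeta> \<in> space M. g \<zeta> \<in> J}"

text \<open>
  The endpoints of the \<open>\<tau>\<close>-integral are left out since \<open>\<Phi>\<close> is differentiated at points of
  \<open>J\<close> only for \<open>0 < \<tau> < 1\<close>; they form a null set.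
\<close>

definition relative_entropy ::
    "'a measure \<Rightarrow> real set \<Rightarrow> (real \<Rightarrow> real) \<Rightarrow> ('a \<Rightarrow> real) \<Rightarrow> ('a \<Rightarrow> real) \<Rightarrow> ennreal" where
  "relative_entropy M J \<Phi> f g =
     (\<integral>\<^sup>+\<tau>\<in>{0<..<1}. ennreal (1 - \<tau>) *
        (\<integral>\<^sup>+\<zeta>. ennreal ((f \<zeta> - g \<zeta>)\<^sup>2 * deriv (deriv \<Phi>) ((1 - \<tau>) * g \<zeta> + \<tau> * f \<zeta>))
           \<partial>measure_in M g J) \<partial>lborel)"

end

theory Submission
  imports Defs
begin

text \<open>
  Fix \<open>\<tau>\<close> and write \<open>k = \<Phi>'' ((1 - \<tau>) g + \<tau> f)\<close>, a positive function on \<open>{g \<in> J}\<close>. Then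
  \<open>(f - g)\<^sup>2 \<omega>\<^sup>2 = ((f - g)\<^sup>2 k) (\<omega>\<^sup>2 / k)\<close>, and Hoelder's inequality with the conjugate
  exponents \<open>2 / r\<close> and \<open>2 / (2 - r)\<close>, applied to the power \<open>r / 2\<close> of this product, bounds
  \<open>N\<^sup>2 = \<parallel>(f - g) \<omega>\<parallel>\<^sup>2\<close> by \<open>\<parallel>\<omega>\<^sup>2 / k\<parallel>\<close> times \<open>\<integral> (f - g)\<^sup>2 k\<close> (lemma \<open>Lnorm_Hoelder\<close>).

  The left-hand side does not depend on \<open>\<tau>\<close>. Moving \<open>\<parallel>\<omega>\<^sup>2 / k\<parallel>\<close> to the left and integrating
  against \<open>(1 - \<tau>) d\<tau>\<close> therefore gives \<open>K N\<^sup>2 \<le> H\<close>, where \<open>H\<close> is the relative entropy, and it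
  remains to divide by \<open>K\<close>.

  Two points need care in \<open>[0, \<infinity>]\<close>, where \<open>0 * \<infinity> = 0\<close>. First, Hoelder's inequality has to hold
  when one factor vanishes and the other is infinite, since dividing by a vanishing
  \<open>\<parallel>\<omega>\<^sup>2 / k\<parallel>\<close> rests on \<open>N = 0\<close>. Secondly, \<open>\<tau> \<mapsto> \<parallel>\<omega>\<^sup>2 / k\<parallel>\<close> is not
  known to be measurable when \<open>\<mu>\<close> is not \<open>\<sigma>\<close>-finite. The inequality
  \<open>c \<integral> u \<le> \<integral> c u\<close> survives this because the integral is a supremum over simple minorants
  (lemma \<open>cmult_nn_integral_le\<close>).
\<close>

section \<open>Nonnegative integrals: scaling and Hoelder's inequality\<close>

text \<open>
  Scaling a simple minorant of \<open>u\<close> by \<open>c\<close> gives a measurable minorant of \<open>c * u\<close>.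
  For non-measurable \<open>u\<close> the integral is the lower one, and the argument is the same.
\<close>

lemma cmult_nn_integral_le:
  "c * (\<integral>\<^sup>+x. u x \<partial>M) \<le> (\<integral>\<^sup>+x. c * u x \<partial>M)"
proof -
  have "c * integral\<^sup>S M s \<le> (\<integral>\<^sup>+x. c * u x \<partial>M)"
    if s: "simple_function M s" "s \<le> u" for s
  proof -
    have "c * integral\<^sup>S M s = (\<integral>\<^sup>+x. c * s x \<partial>M)"
      using s by (simp add: nn_integral_cmult borel_measurable_simple_function
          nn_integral_eq_simple_integral)
    also have "\<dots> \<le> (\<integral>\<^sup>+x. c * u x \<partial>M)"
      using s(2) by (intro nn_integral_mono mult_left_mono) (auto simp: le_fun_def)
    finally show ?thesis .
  qed
  then show ?thesis
    unfolding nn_integral_def[of M u] SUP_mult_left_ennreal by (intro SUP_least) auto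
qed

text \<open>
  Both functions are normalised to have integral one; the pointwise inequality of Young then
  integrates to a bound by \<open>\<theta> + (1 - \<theta>) = 1\<close>. If an integral vanishes, so does the integrand
  on the left.
\<close>

lemma nn_integral_Hoelder:
  fixes a b :: "'a \<Rightarrow> real"
  assumes [measurable]: "a \<in> borel_measurable M" "b \<in> borel_measurable M"
    and nonneg: "\<And>x. x \<in> space M \<Longrightarrow> 0 \<le> a x" "\<And>x. x \<in> space M \<Longrightarrow> 0 \<le> b x"
    and "0 < \<theta>" "\<theta> < 1" "0 \<le> A" "0 \<le> B"
    and A: "(\<integral>\<^sup>+x. ennreal (a x) \<partial>M) = ennreal A"
    and B: "(\<integral>\<^sup>+x. ennreal (b x) \<partial>M) = ennreal B"
  shows "(\<integral>\<^sup>+x. ennreal (a x powr \<theta> * b x powr (1 - \<theta>)) \<partial>M)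
           \<le> ennreal (A powr \<theta> * B powr (1 - \<theta>))"
proof (cases "A = 0 \<or> B = 0")
  case True
  have "AE x in M. a x powr \<theta> * b x powr (1 - \<theta>) = 0"
  proof (cases "A = 0")
    case True
    then have "AE x in M. ennreal (a x) = 0"
      using A by (subst nn_integral_0_iff_AE[symmetric, of "\<lambda>x. ennreal (a x)"]) auto
    with AE_space show ?thesis
      by eventually_elim (use nonneg(1) \<open>0 < \<theta>\<close> in \<open>force simp: ennreal_eq_0_iff\<close>)
  next
    case False
    with True have "B = 0" by simp
    then have "AE x in M. ennreal (b x) = 0"
      using B by (subst nn_integral_0_iff_AE[symmetric, of "\<lambda>x. ennreal (b x)"]) auto
    with AE_space show ?thesis
      by eventually_elim (use nonneg(2) \<open>\<theta> < 1\<close> in \<open>force simp: ennreal_eq_0_iff\<close>)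
  qed
  then have "(\<integral>\<^sup>+x. ennreal (a x powr \<theta> * b x powr (1 - \<theta>)) \<partial>M) = 0"
    by (subst nn_integral_0_iff_AE) auto
  then show ?thesis by simp
next
  case False
  with \<open>0 \<le> A\<close> \<open>0 \<le> B\<close> have pos: "0 < A" "0 < B" by auto
  let ?C = "A powr \<theta> * B powr (1 - \<theta>)"
  have young: "a x powr \<theta> * b x powr (1 - \<theta>)
      \<le> ?C * (\<theta> / A) * a x + ?C * ((1 - \<theta>) / B) * b x" if x: "x \<in> space M" for x
  proof (cases "a x = 0 \<or> b x = 0")
    case True
    then have "a x powr \<theta> * b x powr (1 - \<theta>) = 0" by auto
    moreover have "0 \<le> ?C * (\<theta> / A) * a x + ?C * ((1 - \<theta>) / B) * b x"
      using nonneg x pos \<open>0 < \<theta>\<close> \<open>\<theta> < 1\<close> by (intro add_nonneg_nonneg mult_nonneg_nonneg) auto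
    ultimately show ?thesis by (simp only:)
  next
    case False
    with nonneg x have ab: "0 < a x" "0 < b x" by (metis less_eq_real_def)+
    have "a x powr \<theta> * b x powr (1 - \<theta>) =
        ?C * ((a x / A) powr \<theta> * (b x / B) powr (1 - \<theta>))"
      using ab pos by (simp add: powr_divide)
    also have "\<dots> \<le> ?C * (\<theta> * (a x / A) + (1 - \<theta>) * (b x / B))"
      using ab pos \<open>0 < \<theta>\<close> \<open>\<theta> < 1\<close> by (intro mult_left_mono Youngs_inequality_0) auto
    also have "\<dots> = ?C * (\<theta> / A) * a x + ?C * ((1 - \<theta>) / B) * b x"
      by (simp add: algebra_simps)
    finally show ?thesis .
  qed
  have "(\<integral>\<^sup>+x. ennreal (a x powr \<theta> * b x powr (1 - \<theta>)) \<partial>M)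
      \<le> (\<integral>\<^sup>+x. ennreal (?C * (\<theta> / A)) * ennreal (a x)
              + ennreal (?C * ((1 - \<theta>) / B)) * ennreal (b x) \<partial>M)"
    using young nonneg pos \<open>0 < \<theta>\<close> \<open>\<theta> < 1\<close>
    by (intro nn_integral_mono)
       (simp add: ennreal_leI flip: ennreal_mult ennreal_plus)
  also have "\<dots> = ennreal (?C * (\<theta> / A)) * ennreal A + ennreal (?C * ((1 - \<theta>) / B)) * ennreal B"
    by (simp add: nn_integral_add nn_integral_cmult A B)
  also have "\<dots> = ennreal (?C * (\<theta> / A) * A + ?C * ((1 - \<theta>) / B) * B)"
    using pos \<open>0 < \<theta>\<close> \<open>\<theta> < 1\<close> by (simp flip: ennreal_mult ennreal_plus)
  also have "?C * (\<theta> / A) * A + ?C * ((1 - \<theta>) / B) * B = ?C"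
    using pos by (simp add: field_simps)
  finally show ?thesis .
qed

section \<open>Weighted Hoelder inequality for the norms\<close>

lemma Lnorm_eq_0_iff:
  assumes [measurable]: "h \<in> borel_measurable M" and "0 < q"
  shows "Lnorm q M h = 0 \<longleftrightarrow> (AE x in M. h x = 0)"
proof (cases "q = \<infinity>")
  case True
  have "esssup M (\<lambda>x. ennreal \<bar>h x\<bar>) = 0 \<longleftrightarrow> (AE x in M. ennreal \<bar>h x\<bar> \<le> 0)"
    using esssup_AE[where f = "\<lambda>x. ennreal \<bar>h x\<bar>" and M = M]
      esssup_I[of "\<lambda>x. ennreal \<bar>h x\<bar>" M 0]
    by fastforce
  then show ?thesis
    using True by (simp add: Lnorm_def ennreal_eq_0_iff)
next
  case False
  have "Lnorm q M h = 0 \<longleftrightarrow> (\<integral>\<^sup>+x. ennreal (\<bar>h x\<bar> powr enn2real q) \<partial>M) = 0"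
    using False by (auto simp: Lnorm_def Let_def enn2real_eq_0_iff)
  also have "\<dots> \<longleftrightarrow> (AE x in M. h x = 0)"
    by (subst nn_integral_0_iff_AE) (auto simp: ennreal_eq_0_iff)
  finally show ?thesis .
qed

text \<open>
  For \<open>r = 2\<close> the factor \<open>w\<^sup>2 / k\<close> of \<open>h\<^sup>2 w\<^sup>2\<close> is replaced by its essential supremum.
  For \<open>r < 2\<close> this is Hoelder's inequality for \<open>a = h\<^sup>2 k\<close>, \<open>b = (w\<^sup>2 / k) powr (r / (2 - r))\<close> and
  \<open>\<theta> = r / 2\<close>, unless a factor on the right vanishes, possibly against an infinite one: then
  \<open>h w = 0\<close> almost everywhere.
\<close>

lemma Lnorm_Hoelder:
  fixes h w k :: "'a \<Rightarrow> real" and r :: real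
  defines "q \<equiv> (if r = 2 then \<infinity> else ennreal (r / (2 - r)))"
  assumes [measurable]: "h \<in> borel_measurable M" "w \<in> borel_measurable M" "k \<in> borel_measurable M"
    and k: "\<And>x. x \<in> space M \<Longrightarrow> 0 < k x"
    and r: "1 \<le> r" "r \<le> 2"
  shows "(Lnorm (ennreal r) M (\<lambda>x. h x * w x))\<^sup>2
           \<le> Lnorm q M (\<lambda>x. (w x)\<^sup>2 / k x) * (\<integral>\<^sup>+x. ennreal ((h x)\<^sup>2 * k x) \<partial>M)"
    (is "?N\<^sup>2 \<le> ?B * ?D")
proof (cases "r = 2")
  case True
  let ?I = "\<integral>\<^sup>+x. ennreal (\<bar>h x * w x\<bar> powr 2) \<partial>M"
  have B: "?B = esssup M (\<lambda>x. ennreal \<bar>(w x)\<^sup>2 / k x\<bar>)"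
    using True by (simp add: q_def Lnorm_def)
  have "?N\<^sup>2 = ?I"
  proof (cases "?I = \<infinity>")
    case False
    then have fin: "?I < \<infinity>" by (simp add: less_top)
    have "?N = ennreal (enn2real ?I powr (1 / 2))"
      using False True by (simp add: Lnorm_def Let_def)
    then have "?N\<^sup>2 = ennreal ((enn2real ?I powr (1 / 2))\<^sup>2)"
      by (simp add: ennreal_power)
    also have "(enn2real ?I powr (1 / 2))\<^sup>2 = enn2real ?I"
      by (simp add: powr_half_sqrt)
    finally show ?thesis using fin by simp
  qed (use True in \<open>simp add: Lnorm_def Let_def power2_eq_square\<close>)
  also have "?I \<le> (\<integral>\<^sup>+x. ?B * ennreal ((h x)\<^sup>2 * k x) \<partial>M)"
  proof (rule nn_integral_mono_AE)
    from esssup_AE[where f = "\<lambda>x. ennreal \<bar>(w x)\<^sup>2 / k x\<bar>" and M = M] AE_space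
    show "AE x in M. ennreal (\<bar>h x * w x\<bar> powr 2) \<le> ?B * ennreal ((h x)\<^sup>2 * k x)"
      unfolding B
    proof eventually_elim
      case (elim x)
      then have "\<bar>h x * w x\<bar> powr 2 = \<bar>(w x)\<^sup>2 / k x\<bar> * ((h x)\<^sup>2 * k x)"
        using k[of x] by (simp add: power_mult_distrib)
      then have "ennreal (\<bar>h x * w x\<bar> powr 2) = ennreal \<bar>(w x)\<^sup>2 / k x\<bar> * ennreal ((h x)\<^sup>2 * k x)"
        using k[of x] elim by (subst ennreal_mult[symmetric]) auto
      then show ?case
        using elim(1) by (simp add: mult_right_mono)
    qed
  qed
  also have "\<dots> = ?B * ?D" by (simp add: nn_integral_cmult)
  finally show ?thesis .
next
  case False
  with r have r2: "r < 2" by simp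
  define p where "p = r / (2 - r)"
  have p: "0 < p" "q = ennreal p" using r r2 by (auto simp: p_def q_def)
  let ?b = "\<lambda>x. \<bar>(w x)\<^sup>2 / k x\<bar> powr p"
  let ?Q = "\<integral>\<^sup>+x. ennreal (?b x) \<partial>M"
  let ?I = "\<integral>\<^sup>+x. ennreal (\<bar>h x * w x\<bar> powr r) \<partial>M"
  have B: "?B = (if ?Q = \<infinity> then \<infinity> else ennreal (enn2real ?Q powr (1 / p)))"
    using p by (simp add: Lnorm_def Let_def)
  consider "?B = 0 \<or> ?D = 0" | "?B \<noteq> 0" "?D \<noteq> 0" "?B = \<infinity> \<or> ?D = \<infinity>"
    | "?B \<noteq> \<infinity>" "?D \<noteq> \<infinity>" by blast
  then show ?thesis
  proof cases
    case 1
    have "AE x in M. h x * w x = 0"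
    proof (cases "?B = 0")
      case True
      then have "AE x in M. (w x)\<^sup>2 / k x = 0"
        using p by (subst (asm) Lnorm_eq_0_iff) auto
      with AE_space show ?thesis by eventually_elim (use k in force)
    next
      case False
      with 1 have "AE x in M. ennreal ((h x)\<^sup>2 * k x) = 0"
        by (subst nn_integral_0_iff_AE[symmetric]) auto
      with AE_space show ?thesis
      proof eventually_elim
        case (elim x)
        then have "(h x)\<^sup>2 * k x \<le> 0" by (simp add: ennreal_eq_0_iff)
        then show ?case using k[of x] elim by (simp add: mult_le_0_iff)
      qed
    qed
    then have "?N = 0" using r by (subst Lnorm_eq_0_iff) auto
    then show ?thesis by simp
  next
    case 2
    then have "?B * ?D = \<infinity>" by (auto simp: ennreal_mult_eq_top_iff)
    then show ?thesis by simp
  next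
    case 3
    define D where "D = enn2real ?D"
    define Q where "Q = enn2real ?Q"
    have Q_fin: "?Q \<noteq> \<infinity>" using 3(1) B by auto
    have D: "?D = ennreal D" "0 \<le> D"
      using 3(2) by (simp_all add: D_def less_top)
    have Q: "?Q = ennreal Q" "0 \<le> Q"
      using Q_fin by (simp_all add: Q_def less_top)
    have "\<bar>h x * w x\<bar> powr r = ((h x)\<^sup>2 * k x) powr (r / 2) * ?b x powr (1 - r / 2)"
      if x: "x \<in> space M" for x
    proof -
      have e: "p * (1 - r / 2) = r / 2" using r2 by (simp add: p_def field_simps)
      have "((h x)\<^sup>2 * k x) powr (r / 2) * ?b x powr (1 - r / 2)
          = ((h x)\<^sup>2 * k x * ((w x)\<^sup>2 / k x)) powr (r / 2)"
        using k[OF x] by (simp add: powr_powr e powr_mult del: times_divide_eq_right)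
      also have "(h x)\<^sup>2 * k x * ((w x)\<^sup>2 / k x) = \<bar>h x * w x\<bar> powr 2"
        using k[OF x] by (simp add: power_mult_distrib)
      finally show ?thesis by (simp add: powr_powr del: powr_numeral)
    qed
    then have "?I = (\<integral>\<^sup>+x. ennreal (((h x)\<^sup>2 * k x) powr (r / 2) * ?b x powr (1 - r / 2)) \<partial>M)"
      by (intro nn_integral_cong) simp
    also have "\<dots> \<le> ennreal (D powr (r / 2) * Q powr (1 - r / 2))"
      using k r r2 D Q by (intro nn_integral_Hoelder)
         (auto intro!: mult_nonneg_nonneg intro: less_imp_le)
    finally have I: "?I \<le> ennreal (D powr (r / 2) * Q powr (1 - r / 2))" .
    then have I_fin: "?I \<noteq> \<infinity>" by (auto simp: top_unique)
    have I': "enn2real ?I \<le> D powr (r / 2) * Q powr (1 - r / 2)"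
      using I by (intro enn2real_leI) auto
    have "?N\<^sup>2 = ennreal ((enn2real ?I powr (1 / r))\<^sup>2)"
      using I_fin r by (simp add: Lnorm_def Let_def ennreal_power)
    also have "(enn2real ?I powr (1 / r))\<^sup>2 = enn2real ?I powr (2 / r)"
      by (simp add: power2_eq_square flip: powr_add)
    also have "ennreal \<dots> \<le> ennreal ((D powr (r / 2) * Q powr (1 - r / 2)) powr (2 / r))"
      using I' r by (intro ennreal_leI powr_mono2) auto
    also have "(D powr (r / 2) * Q powr (1 - r / 2)) powr (2 / r) = Q powr (1 / p) * D"
    proof -
      have e: "(1 - r / 2) * (2 / r) = 1 / p" "r / 2 * (2 / r) = 1"
        using r r2 by (simp_all add: p_def field_simps)
      have "(D powr (r / 2) * Q powr (1 - r / 2)) powr (2 / r)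
          = D powr (r / 2 * (2 / r)) * Q powr ((1 - r / 2) * (2 / r))"
        by (simp only: powr_mult powr_powr powr_ge_zero)
      then show ?thesis using D(2) unfolding e by simp
    qed
    also have "ennreal (Q powr (1 / p) * D) = ?B * ?D"
      using B Q_fin D by (simp add: Q_def ennreal_mult)
    finally show ?thesis .
  qed
qed

section \<open>Division in the extended nonnegative reals\<close>

text \<open>
  Division is valid at the degenerate values as well: \<open>y = 0\<close> forces \<open>x = 0\<close>, and \<open>y = \<infinity>\<close>
  has inverse \<open>0\<close>.
\<close>

lemma ennreal_inverse_mult_le:
  fixes x y z :: ennreal
  assumes "x \<le> y * z"
  shows "inverse y * x \<le> z"
proof -
  consider "y = 0" | "y = \<infinity>" | "y \<noteq> 0" "y \<noteq> \<infinity>" by blast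
  then show ?thesis
  proof cases
    case 3
    have "inverse y * x \<le> inverse y * (y * z)" using assms by (rule mult_left_mono) simp
    also have "\<dots> = (y * inverse y) * z" by (simp add: ac_simps)
    also have "y * inverse y = 1"
      using 3 ennreal_divide_self[of y] by (simp add: divide_ennreal_def less_top)
    finally show ?thesis by simp
  qed (use assms in simp_all)
qed

text \<open>
  At \<open>c = \<infinity>\<close>, finiteness of \<open>z\<close> forces \<open>x = 0\<close>.
\<close>

lemma ennreal_le_inverse_mult:
  fixes c x z :: ennreal
  assumes "c * x \<le> z" and "c \<noteq> 0" and "z < \<infinity>"
  shows "x \<le> inverse c * z"
proof (cases "c = \<infinity>")
  case True
  then have "x = 0"
    using assms by (cases "x = 0") (auto simp: ennreal_top_mult top_unique)
  then show ?thesis by simp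
next
  case False
  have "inverse c * c = 1"
    using False \<open>c \<noteq> 0\<close> ennreal_divide_self[of c]
    by (simp add: divide_ennreal_def less_top mult.commute)
  then have "x = inverse c * (c * x)" by (simp flip: mult.assoc)
  also have "\<dots> \<le> inverse c * z"
    using assms(1) by (rule mult_left_mono) simp
  finally show ?thesis .
qed

section \<open>The entropy inequality\<close>

theorem proposition16:
  fixes M :: "'a measure" and J :: "real set" and \<Phi> :: "real \<Rightarrow> real"
    and \<omega> f g :: "'a \<Rightarrow> real" and r :: real
  defines "q \<equiv> (if r = 2 then \<infinity> else ennreal (r / (2 - r)))"
  defines "K \<equiv> (\<integral>\<^sup>+\<tau>\<in>{0<..<1}. ennreal (1 - \<tau>) *
      inverse (Lnorm q (measure_in M g J)
        (\<lambda>\<zeta>. (\<omega> \<zeta>)\<^sup>2 / deriv (deriv \<Phi>) ((1 - \<tau>) * g \<zeta> + \<tau> * f \<zeta>))) \<partial>lborel)"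
  assumes "open J" and "is_interval J"
    and "C2_on J \<Phi>" and "continuous_on (closure J) \<Phi>"
    and "\<And>x. x \<in> J \<Longrightarrow> deriv (deriv \<Phi>) x > 0"
    and "\<omega> \<in> borel_measurable M" and "\<And>\<zeta>. \<zeta> \<in> space M \<Longrightarrow> 0 \<le> \<omega> \<zeta>"
    and "1 \<le> r" and "r \<le> 2"
    and "f \<in> M \<rightarrow>\<^sub>M restrict_space borel (closure J)"
    and "g \<in> M \<rightarrow>\<^sub>M restrict_space borel (closure J)"
    and "Lnorm (ennreal r) (measure_in M g J) (\<lambda>\<zeta>. (f \<zeta> - g \<zeta>) * \<omega> \<zeta>) < \<infinity>"
    and "inverse K < \<infinity>"
    and "relative_entropy M J \<Phi> f g < \<infinity>"
  shows "(Lnorm (ennreal r) (measure_in M g J) (\<lambda>\<zeta>. (f \<zeta> - g \<zeta>) * \<omega> \<zeta>))\<^sup>2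
           \<le> inverse K * relative_entropy M J \<Phi> f g"
proof -
  let ?L = "measure_in M g J"
  let ?N = "Lnorm (ennreal r) ?L (\<lambda>\<zeta>. (f \<zeta> - g \<zeta>) * \<omega> \<zeta>)"
  let ?k = "\<lambda>\<tau> \<zeta>. deriv (deriv \<Phi>) ((1 - \<tau>) * g \<zeta> + \<tau> * f \<zeta>)"
  let ?B = "\<lambda>\<tau>. Lnorm q ?L (\<lambda>\<zeta>. (\<omega> \<zeta>)\<^sup>2 / ?k \<tau> \<zeta>)"
  let ?D = "\<lambda>\<tau>. \<integral>\<^sup>+\<zeta>. ennreal ((f \<zeta> - g \<zeta>)\<^sup>2 * ?k \<tau> \<zeta>) \<partial>?L"
  have f: "f \<in> borel_measurable M" "\<And>\<zeta>. \<zeta> \<in> space M \<Longrightarrow> f \<zeta> \<in> closure J"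
    and g: "g \<in> borel_measurable M"
    using assms(12,13) by (auto simp: measurable_restrict_space2_iff)
  have meas: "f \<in> borel_measurable ?L" "g \<in> borel_measurable ?L" "\<omega> \<in> borel_measurable ?L"
    unfolding measure_in_def using f g assms(8) by (auto intro: measurable_restrict_space1)
  have space: "\<zeta> \<in> space M" "g \<zeta> \<in> J" if "\<zeta> \<in> space ?L" for \<zeta>
    using that by (auto simp: measure_in_def space_restrict_space)
  have in_J: "(1 - \<tau>) * g \<zeta> + \<tau> * f \<zeta> \<in> J" if "\<zeta> \<in> space ?L" "\<tau> \<in> {0<..<1}" for \<tau> \<zeta>
  proof -
    \<comment> \<open>A half-open segment from an interior point to a point of the closure stays inside.\<close>
    have "f \<zeta> - (1 - \<tau>) *\<^sub>R (f \<zeta> - g \<zeta>) \<in> interior J"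
      using that space f(2) \<open>open J\<close> \<open>is_interval J\<close>
      by (intro mem_interior_closure_convex_shrink)
         (auto simp: is_interval_convex interior_open)
    then show ?thesis
      using \<open>open J\<close> by (simp add: interior_open algebra_simps)
  qed
  have k_meas: "?k \<tau> \<in> borel_measurable ?L" if "\<tau> \<in> {0<..<1}" for \<tau>
  proof -
    have "(\<lambda>\<zeta>. (1 - \<tau>) * g \<zeta> + \<tau> * f \<zeta>) \<in> ?L \<rightarrow>\<^sub>M restrict_space borel J"
      using meas in_J that by (intro measurable_restrict_space2) auto
    moreover have "deriv (deriv \<Phi>) \<in> borel_measurable (restrict_space borel J)"
      using \<open>C2_on J \<Phi>\<close> by (intro borel_measurable_continuous_on_restrict) (simp add: C2_on_def)
    ultimately show ?thesis by (rule measurable_compose)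
  qed
  have pointwise: "inverse (?B \<tau>) * ?N\<^sup>2 \<le> ?D \<tau>" if "\<tau> \<in> {0<..<1}" for \<tau>
    unfolding q_def using that meas k_meas assms(7) in_J \<open>1 \<le> r\<close> \<open>r \<le> 2\<close>
    by (intro ennreal_inverse_mult_le Lnorm_Hoelder) auto
  have "?N\<^sup>2 * K
      \<le> (\<integral>\<^sup>+\<tau>. ?N\<^sup>2 * (ennreal (1 - \<tau>) * inverse (?B \<tau>) * indicator {0<..<1} \<tau>) \<partial>lborel)"
    unfolding K_def by (rule cmult_nn_integral_le)
  also have "\<dots> \<le> relative_entropy M J \<Phi> f g"
    unfolding relative_entropy_def
  proof (rule nn_integral_mono)
    fix \<tau> :: real
    show "?N\<^sup>2 * (ennreal (1 - \<tau>) * inverse (?B \<tau>) * indicator {0<..<1} \<tau>)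
        \<le> ennreal (1 - \<tau>) * ?D \<tau> * indicator {0<..<1} \<tau>"
    proof (cases "\<tau> \<in> {0<..<1}")
      case True
      have "?N\<^sup>2 * (ennreal (1 - \<tau>) * inverse (?B \<tau>))
          = ennreal (1 - \<tau>) * (inverse (?B \<tau>) * ?N\<^sup>2)"
        by (simp add: ac_simps)
      also have "\<dots> \<le> ennreal (1 - \<tau>) * ?D \<tau>"
        using pointwise[OF True] by (rule mult_left_mono) simp
      finally show ?thesis using True by simp
    qed simp
  qed
  finally have "K * ?N\<^sup>2 \<le> relative_entropy M J \<Phi> f g" by (simp add: mult.commute)
  moreover have "K \<noteq> 0" using \<open>inverse K < \<infinity>\<close> by auto
  ultimately show ?thesis
    using \<open>relative_entropy M J \<Phi> f g < \<infinity>\<close> by (intro ennreal_le_inverse_mult)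
qed

end
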